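(* Let $\sigma\in\mathcal K$. Then for every open cube $Q\subset\mathbb R^n$ we have $$\limsup_{t\to\infty}\int_{Q\cap\Omega}\nu^{(\sigma)}_{m+t}\,dx\leqslant M_\sigma\,\mathrm{meas}(Q\cap\Omega).$$
   Context: Here $\mathbb N=\{1,2,\dots\}$, $n\in\mathbb N$, $n\geqslant 2$, $\Omega$ is a bounded domain (nonempty open connected set) of $\mathbb R^n$, $|\cdot|$ is the Euclidean norm and $\mathrm{meas}$ is the $n$-dimensional Lebesgue measure. For $y\in\mathbb R^n$, $\rho>0$ let $B(y,\rho)=\{x\in\mathbb R^n:|x-y|<\rho\}$; for $y\in\mathbb R^n$, $t\in\mathbb N$ let $Q_t(y)=\{x\in\mathbb R^n:|x_i-y_i|<\frac1{2t},\ i=1,\dots,n\}$. Let $Y_t=\{y\in\mathbb R^n: t y_i\in\mathbb Z,\ i=1,\dots,n\}$ and $X_t=\{y\in Y_t: Q_t(y)\subset\Omega\}$. A number $m\in\mathbb N$ is fixed such that $X_t\neq\emptyset$ for every $t\in\mathbb N$, $t>m$ (such $m$ exists). For $t>m$ let $G_t=\bigcup_{y\in X_t}B(y,\frac1{2t})\subset\Omega$, let $\chi_t:\Omega\to\mathbb R$ be the characteristic function of $G_t$ and, for $y\in X_t$, let $\chi_{t,y}:\Omega\to\mathbb R$ be the characteristic function of $B(y,\frac1{2t})$. $\mathcal K$ is the set of all functions $\sigma:[0,+\infty)\to(0,+\infty)$ such that: (i) $\sigma$ is continuous in $(0,+\infty)$; (ii) $\sigma\geqslant1$ in $[0,1]$;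 (iii) $\sigma(\rho)\to+\infty$ as $\rho>0$, $\rho\to0$; (iv) $\int_0^1\sigma(\rho)\rho^{n-1}d\rho<+\infty$. For $\sigma\in\mathcal K$ set $M_\sigma=\sigma(1)+n\int_0^1\sigma(\rho)\rho^{n-1}d\rho$. For $\sigma\in\mathcal K$ and $t\in\mathbb N$, $t>m$, the function $\nu_t^{(\sigma)}:\Omega\to\mathbb R$ is defined by $\nu_t^{(\sigma)}(x)=\sigma(1)(1-\chi_t(x))+\sum_{y\in X_t}\sigma(2t|x-y|)\chi_{t,y}(x)$. An open cube is a set of the form $\{x\in\mathbb R^n:|x_i-z_i|<a/2,\ i=1,\dots,n\}$ with $z\in\mathbb R^n$, $a>0$. *)

theory Defs
  imports "HOL-Analysis.Analysis"
begin

text \<open>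
  The space R^n is \<open>real^'n\<close> with \<open>n = CARD('n)\<close>. Functions that are defined on \<open>\<Omega>\<close> or on
  \<open>[0, \<infinity>)\<close> are total functions here; only their values on that domain are ever constrained
  or used. The balls \<open>B(y, \<rho>)\<close> are the library's \<open>ball y \<rho>\<close>.
\<close>

definition open_cube :: "real^'n \<Rightarrow> real \<Rightarrow> (real^'n) set" where
  "open_cube z a = {x. \<forall>i. \<bar>x $ i - z $ i\<bar> < a / 2}"

definition Q_cube :: "nat \<Rightarrow> real^'n \<Rightarrow> (real^'n) set" where
  "Q_cube t y = {x. \<forall>i. \<bar>x $ i - y $ i\<bar> < 1 / (2 * real t)}"

definition Y_lattice :: "nat \<Rightarrow> (real^'n) set" where
  "Y_lattice t = {y. \<forall>i. real t * y $ i \<in> \<int>}"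

definition X_centres :: "(real^'n) set \<Rightarrow> nat \<Rightarrow> (real^'n) set" where
  "X_centres \<Omega> t = {y \<in> Y_lattice t. Q_cube t y \<subseteq> \<Omega>}"

definition G_balls :: "(real^'n) set \<Rightarrow> nat \<Rightarrow> (real^'n) set" where
  "G_balls \<Omega> t = (\<Union>y\<in>X_centres \<Omega> t. ball y (1 / (2 * real t)))"

definition K_class :: "nat \<Rightarrow> (real \<Rightarrow> real) set" where
  "K_class n = {\<sigma>.
     (\<forall>\<rho>\<ge>0. 0 < \<sigma> \<rho>) \<and>
     continuous_on {0<..} \<sigma> \<and>
     (\<forall>\<rho>\<in>{0..1}. 1 \<le> \<sigma> \<rho>) \<and>
     filterlim \<sigma> at_top (at_right 0) \<and>
     set_integrable lborel {0..1} (\<lambda>\<rho>. \<sigma> \<rho> * \<rho> ^ (n - 1))}"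

definition M_const :: "nat \<Rightarrow> (real \<Rightarrow> real) \<Rightarrow> real" where
  "M_const n \<sigma> = \<sigma> 1 + real n * (LINT \<rho>:{0..1}|lborel. \<sigma> \<rho> * \<rho> ^ (n - 1))"

text \<open>
  The sum below is over a finite set whenever \<open>\<Omega>\<close> is bounded and \<open>t \<ge> 1\<close>: the centres
  lie in \<open>\<Omega>\<close> and on a lattice of mesh \<open>1/t\<close>.
\<close>

definition nu :: "(real^'n) set \<Rightarrow> (real \<Rightarrow> real) \<Rightarrow> nat \<Rightarrow> real^'n \<Rightarrow> real" where
  "nu \<Omega> \<sigma> t x =
     \<sigma> 1 * (1 - indicator (G_balls \<Omega> t) x) +
     (\<Sum>y\<in>X_centres \<Omega> t. \<sigma> (2 * real t * norm (x - y)) * indicator (ball y (1 / (2 * real t))) x)"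

end

theory Submission
  imports Defs
begin

text \<open>
  The part of \<open>\<nu>\<^sub>t\<close> outside the balls contributes at most \<open>\<sigma>(1) meas(Q \<inter> \<Omega>)\<close>. In polar
  coordinates one ball of radius \<open>1/(2t)\<close> contributes \<open>n \<omega>\<^sub>n (2t)\<^sup>-\<^sup>n \<integral>\<^sub>0\<^sup>1 \<sigma>(\<rho>) \<rho>\<^sup>n\<^sup>-\<^sup>1 d\<rho>\<close>, where
  \<open>\<omega>\<^sub>n\<close> is the volume of the unit ball. Since \<open>\<omega>\<^sub>n \<le> 2\<^sup>n\<close>, this is at most
  \<open>n \<integral>\<^sub>0\<^sup>1 \<sigma>(\<rho>) \<rho>\<^sup>n\<^sup>-\<^sup>1 d\<rho>\<close> times the volume of the cube \<open>Q\<^sub>t(y)\<close> around the ball. The cubes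
  whose balls meet \<open>Q\<close> are disjoint and lie in \<open>\<Omega>\<close> and in the cube with the centre of \<open>Q\<close> and side
  \<open>a + 2/t\<close>, so their total volume exceeds \<open>meas(Q \<inter> \<Omega>)\<close> by at most \<open>(a + 2/t)\<^sup>n - a\<^sup>n\<close>, which
  tends to 0.
\<close>

section \<open>Polar coordinates on a ball\<close>

text \<open>Two Borel measures that are finite and equal on all rays \<open>{s<..}\<close> coincide.
  On such a ray the pushforward gives the volume of a ball minus a concentric smaller one, and the
  density integrates to the same difference because \<open>d * \<rho> ^ (d - 1)\<close> is the
  derivative of \<open>\<rho> ^ d\<close>.\<close>

lemma distr_ball_norm:
  fixes y :: "'a::euclidean_space"
  assumes r: "0 < r"
  defines "d \<equiv> DIM('a)"
  shows "distr (density lborel (indicator (ball y r))) borel (\<lambda>x. norm (x - y) / r) =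
    density lborel (\<lambda>\<rho>. ennreal (unit_ball_vol d * r ^ d * (d * \<rho> ^ (d - 1))) * indicator {0..1} \<rho>)"
    (is "?M = ?N")
proof -
  define V where "V = unit_ball_vol d * r ^ d"
  have V: "0 \<le> V" using r by (simp add: V_def)
  have d: "0 < d" by (simp add: d_def)
  have ball_meas [measurable]: "ball y r \<in> sets borel" by simp
  \<comment> \<open>The term \<open>max 0 (min 1 s)\<close> clamps \<open>s\<close> to
    \<open>[0, 1]\<close>, so that one formula covers rays starting below, inside and above the
    range of the normalised distance.\<close>
  have M: "emeasure ?M {s<..} = ennreal (V * (1 - max 0 (min 1 s) ^ d))" for s
  proof -
    have "emeasure ?M {s<..} = emeasure (density lborel (indicator (ball y r))) {x. s < norm (x - y) / r}"
      by (subst emeasure_distr) (auto simp: vimage_def)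
    also have "\<dots> = emeasure lborel (ball y r \<inter> {x. s < norm (x - y) / r})"
      by (rule emeasure_restricted) auto
    also have "\<dots> = ennreal (V * (1 - max 0 (min 1 s) ^ d))"
    proof -
      consider "s < 0" | "1 \<le> s" | "0 \<le> s" "s < 1" by linarith
      then show ?thesis
      proof cases
        case 1
        then have "s < norm (x - y) / r" for x
          using r by (smt (verit) divide_nonneg_pos norm_ge_zero)
        then have "ball y r \<inter> {x. s < norm (x - y) / r} = ball y r" by auto
        then show ?thesis
          using 1 r d by (simp add: emeasure_ball V_def d_def max_def min_def zero_power)
      next
        case 2
        have "ball y r \<inter> {x. s < norm (x - y) / r} = {}"
        proof -
          have "\<not> s < norm (x - y) / r" if "norm (x - y) < r" for x
            using that 2 r by (simp add: field_simps not_less) (smt (verit) mult_le_cancel_left1)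
          then show ?thesis by (auto simp: dist_norm norm_minus_commute)
        qed
        then show ?thesis using 2 by simp
      next
        case 3
        have "ball y r \<inter> {x. s < norm (x - y) / r} = ball y r - cball y (r * s)"
          using r by (auto simp: dist_norm norm_minus_commute field_simps)
        moreover have "cball y (r * s) \<subseteq> ball y r" using 3 r by (simp add: cball_subset_ball_iff)
        ultimately have "emeasure lborel (ball y r \<inter> {x. s < norm (x - y) / r})
            = emeasure lborel (ball y r) - emeasure lborel (cball y (r * s))"
          using emeasure_lborel_cball_finite[of y "r * s"] by (simp add: emeasure_Diff less_top)
        also have "\<dots> = ennreal (V - V * s ^ d)"
          using 3 r V by (simp add: emeasure_ball emeasure_cball V_def d_def ennreal_minus power_mult_distrib mult.assoc)
        finally show ?thesis using 3 by (simp add: algebra_simps)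
      qed
    qed
    finally show ?thesis .
  qed
  have N: "emeasure ?N {s<..} = ennreal (V * (1 - max 0 (min 1 s) ^ d))" for s
  proof -
    define u where "u = max 0 (min 1 s)"
    have u: "0 \<le> u" "u \<le> 1" by (auto simp: u_def)
    have "emeasure ?N {s<..} = (\<integral>\<^sup>+\<rho>. ennreal (V * (d * \<rho> ^ (d - 1))) * indicator {0..1} \<rho> * indicator {s<..} \<rho> \<partial>lborel)"
      by (subst emeasure_density) (auto simp: V_def)
    also have "\<dots> = (\<integral>\<^sup>+\<rho>. ennreal (V * (d * \<rho> ^ (d - 1))) * indicator {u..1} \<rho> \<partial>lborel)"
    proof (rule nn_integral_cong_AE)
      show "AE \<rho> in lborel. ennreal (V * (d * \<rho> ^ (d - 1))) * indicator {0..1} \<rho> * indicator {s<..} \<rho>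
          = ennreal (V * (d * \<rho> ^ (d - 1))) * indicator {u..1} \<rho>"
        \<comment> \<open>The half-open range \<open>\<rho> > s\<close> and the closed interval from
          \<open>u\<close> differ inside \<open>{0..1}\<close> at most at the point
          \<open>u\<close>.\<close>
        using AE_lborel_singleton[of u] 
        by eventually_elim (auto simp: u_def indicator_def max_def min_def split: if_splits)
    qed
    also have "\<dots> = ennreal (V * 1 ^ d - V * u ^ d)"
      using u V by (intro nn_integral_FTC_Icc) (auto intro!: derivative_eq_intros)
    finally show ?thesis by (simp add: u_def algebra_simps)
  qed
  show ?thesis
    by (rule measure_eqI_lessThan) (simp_all only: M N, simp_all)
qed

text \<open>The integrand depends on \<open>x\<close> only through \<open>norm (x - y) / r\<close>,
  so the integral can be taken against the pushforward computed in
  \<open>distr_ball_norm\<close>.\<close>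

lemma nn_integral_radial_ball:
  fixes y :: "'a::euclidean_space" and f :: "real \<Rightarrow> ennreal"
  assumes r: "0 < r" and [measurable]: "f \<in> borel_measurable borel"
  shows "(\<integral>\<^sup>+x. f (norm (x - y) / r) * indicator (ball y r) x \<partial>lborel) =
    ennreal (unit_ball_vol DIM('a) * r ^ DIM('a) * DIM('a)) *
    (\<integral>\<^sup>+\<rho>. f \<rho> * ennreal (\<rho> ^ (DIM('a) - 1)) * indicator {0..1} \<rho> \<partial>lborel)"
proof -
  have ball_meas [measurable]: "ball y r \<in> sets borel" by simp
  let ?c = "unit_ball_vol DIM('a) * r ^ DIM('a) * DIM('a)"
  let ?w = "\<lambda>\<rho>::real. ennreal (unit_ball_vol DIM('a) * r ^ DIM('a) * (DIM('a) * \<rho> ^ (DIM('a) - 1))) * indicator {0..1} \<rho>"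
  have "(\<integral>\<^sup>+x. f (norm (x - y) / r) * indicator (ball y r) x \<partial>lborel)
      = (\<integral>\<^sup>+x. f (norm (x - y) / r) \<partial>density lborel (indicator (ball y r)))"
    by (subst nn_integral_density) (auto simp: mult.commute)
  also have "\<dots> = (\<integral>\<^sup>+\<rho>. f \<rho> \<partial>distr (density lborel (indicator (ball y r))) borel (\<lambda>x. norm (x - y) / r))"
    by (subst nn_integral_distr) auto
  also have "\<dots> = (\<integral>\<^sup>+\<rho>. ?w \<rho> * f \<rho> \<partial>lborel)"
    by (subst distr_ball_norm[OF r]) (auto simp: nn_integral_density)
  also have "\<dots> = (\<integral>\<^sup>+\<rho>. ennreal ?c * (f \<rho> * ennreal (\<rho> ^ (DIM('a) - 1)) * indicator {0..1} \<rho>) \<partial>lborel)"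
    using r
    by (intro nn_integral_cong) (auto simp: indicator_def ennreal_mult' mult_ac split: if_splits)
  also have "\<dots> = ennreal ?c * (\<integral>\<^sup>+\<rho>. f \<rho> * ennreal (\<rho> ^ (DIM('a) - 1)) * indicator {0..1} \<rho> \<partial>lborel)"
    by (subst nn_integral_cmult) auto
  finally show ?thesis .
qed

section \<open>Volumes of cubes and packing of lattice cubes\<close>

lemma open_cube_eq_box: "open_cube z a = box (\<chi> i. z $ i - a / 2) (\<chi> i. z $ i + a / 2)"
proof -
  have "\<bar>u - v\<bar> < a / 2 \<longleftrightarrow> v - a / 2 < u \<and> u < v + a / 2" for u v :: real by argo
  then show ?thesis by (auto simp: open_cube_def mem_box_cart)
qed

lemma open_cube_lmeasurable: "open_cube z a \<in> lmeasurable"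
  by (simp add: open_cube_eq_box)

lemma Q_cube_eq_open_cube: "Q_cube t y = open_cube y (1 / real t)"
  by (simp add: Q_cube_def open_cube_def mult.commute)

lemma measure_open_cube:
  fixes z :: "real^'n"
  assumes "0 < a"
  shows "measure lebesgue (open_cube z a) = a ^ CARD('n)"
proof -
  let ?l = "\<chi> i. z $ i - a / 2" and ?u = "\<chi> i. z $ i + a / 2"
  have "cbox ?l ?u \<noteq> {}"
    using assms by (auto simp: interval_ne_empty_cart)
  then have "measure lborel (cbox ?l ?u) = a ^ CARD('n)"
    by (simp add: content_cbox_cart)
  moreover have "measure lborel (box ?l ?u) = measure lborel (cbox ?l ?u)"
    by (simp add: measure_lborel_box_eq measure_lborel_cbox_eq)
  ultimately show ?thesis
    by (simp add: open_cube_eq_box measure_completion)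
qed

text \<open>The unit ball lies in the concentric cube of side 2.\<close>

lemma unit_ball_vol_le_two_power: "unit_ball_vol (real CARD('n::finite)) \<le> 2 ^ CARD('n)"
proof -
  have "ball (0::real^'n) 1 \<subseteq> open_cube 0 2"
  proof
    fix x :: "real^'n" assume "x \<in> ball 0 1"
    then have "\<bar>x $ i\<bar> < 1" for i using component_le_norm_cart[of x i] by simp
    then show "x \<in> open_cube 0 2" by (simp add: open_cube_def)
  qed
  then have "measure lebesgue (ball (0::real^'n) 1) \<le> measure lebesgue (open_cube (0::real^'n) 2)"
    by (intro measure_mono_fmeasurable) (auto simp: open_cube_lmeasurable)
  then show ?thesis
    by (simp add: measure_open_cube measure_completion content_ball)
qed

text \<open>Distinct lattice points differ in some coordinate by at least \<open>1 / real t\<close>,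
  which is the side of the cubes.\<close>

lemma disjoint_Q_cubes:
  assumes t: "0 < t"
  shows "disjoint_family_on (Q_cube t) (Y_lattice t)"
proof (unfold disjoint_family_on_def, intro ballI impI)
  fix y y' :: "real^'n" assume y: "y \<in> Y_lattice t" "y' \<in> Y_lattice t" "y \<noteq> y'"
  then obtain i where i: "y $ i \<noteq> y' $ i" by (auto simp: vec_eq_iff)
  have "real t * y $ i - real t * y' $ i \<in> \<int>" using y by (auto simp: Y_lattice_def)
  then have "1 \<le> \<bar>real t * y $ i - real t * y' $ i\<bar>"
    using i t by (intro Ints_nonzero_abs_ge1) auto
  also have "\<dots> = real t * \<bar>y $ i - y' $ i\<bar>"
    by (simp add: abs_mult flip: right_diff_distrib)
  finally have 1: "1 / real t \<le> \<bar>y $ i - y' $ i\<bar>"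
    using t by (simp add: divide_le_eq mult.commute)
  show "Q_cube t y \<inter> Q_cube t y' = {}"
  proof (rule equals0I)
    fix x assume "x \<in> Q_cube t y \<inter> Q_cube t y'"
    then have "\<bar>x $ i - y $ i\<bar> < 1 / (2 * real t)" "\<bar>x $ i - y' $ i\<bar> < 1 / (2 * real t)"
      by (auto simp: Q_cube_def)
    with 1 show False by (simp add: field_simps)
  qed
qed

text \<open>A packing bound: the cubes are disjoint and each has volume
  \<open>1 / real t ^ CARD('n)\<close>. It serves both to show that there are finitely many centres
  and to count those whose balls meet the given cube.\<close>

lemma card_lattice_cubes_le:
  fixes F :: "(real^'n) set"
  assumes t: "0 < t" and F: "finite F" "F \<subseteq> Y_lattice t"
    and sub: "\<And>y. y \<in> F \<Longrightarrow> Q_cube t y \<subseteq> S" and S: "S \<in> lmeasurable"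
  shows "real (card F) / real t ^ CARD('n) \<le> measure lebesgue S"
proof -
  have "real (card F) / real t ^ CARD('n) = (\<Sum>y\<in>F. measure lebesgue (Q_cube t y))"
    using t by (simp add: Q_cube_eq_open_cube measure_open_cube power_divide)
  also have "\<dots> = measure lebesgue (\<Union>y\<in>F. Q_cube t y)"
  proof (rule measure_finite_Union[symmetric])
    show "disjoint_family_on (Q_cube t) F"
      using disjoint_family_on_mono[OF F(2) disjoint_Q_cubes[OF t]] .
    show "Q_cube t ` F \<subseteq> sets lebesgue" "emeasure lebesgue (Q_cube t y) \<noteq> \<infinity>" for y
      using open_cube_lmeasurable[of y "1 / real t"] open_cube_lmeasurable[THEN fmeasurableD]
      by (auto simp: Q_cube_eq_open_cube fmeasurable_def simp del: emeasure_completion)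
  qed fact
  also have "\<dots> \<le> measure lebesgue S"
    using sub S F(1) open_cube_lmeasurable[THEN fmeasurableD]
    by (intro measure_mono_fmeasurable sets.finite_UN) (auto simp: Q_cube_eq_open_cube)
  finally show ?thesis .
qed

text \<open>Packing into \<open>\<Omega>\<close> bounds the size of all finite subsets uniformly,
  and this forces finiteness.\<close>

lemma finite_X_centres:
  fixes \<Omega> :: "(real^'n) set"
  assumes t: "0 < t" and S: "\<Omega> \<in> lmeasurable"
  shows "finite (X_centres \<Omega> t)"
proof -
  have "card F \<le> nat \<lfloor>measure lebesgue \<Omega> * real t ^ CARD('n)\<rfloor>" if "F \<subseteq> X_centres \<Omega> t" "finite F" for F
  proof -
    have "real (card F) / real t ^ CARD('n) \<le> measure lebesgue \<Omega>"
      using that by (intro card_lattice_cubes_le t S) (auto simp: X_centres_def)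
    then show ?thesis using t by (simp add: field_simps le_nat_floor)
  qed
  then show ?thesis using finite_if_finite_subsets_card_bdd by blast
qed

section \<open>The contribution of a single ball\<close>

text \<open>In polar coordinates the factor is \<open>unit_ball_vol\<close> times the power of the
  radius \<open>1 / (2 * real t)\<close>. Bounding the former by the power of 2 cancels the 2 in the
  radius and leaves the volume of \<open>Q_cube t y\<close>.\<close>

lemma K_class_ball_integral:
  fixes y :: "real^'n"
  assumes \<sigma>: "\<sigma> \<in> K_class CARD('n)" and t: "0 < t"
  defines "f \<equiv> \<lambda>x. \<sigma> (2 * real t * norm (x - y)) * indicator (ball y (1 / (2 * real t))) x"
  shows "f \<in> borel_measurable borel" "integrable lborel f"
    "integral\<^sup>L lborel f \<le>
      real CARD('n) * (LINT \<rho>:{0..1}|lborel. \<sigma> \<rho> * \<rho> ^ (CARD('n) - 1)) / real t ^ CARD('n)"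
proof -
  let ?n = "CARD('n)"
  define r where "r = 1 / (2 * real t)"
  have r: "0 < r" using t by (simp add: r_def)
  have ball_meas [measurable]: "ball y r \<in> sets borel" by simp
  \<comment> \<open>\<open>\<sigma>\<close> is arbitrary on the negative reals; \<open>g\<close> is a Borel function that agrees with it on \<open>[0, \<infinity>)\<close>.\<close>
  define g where "g \<rho> = indicator {0<..} \<rho> *\<^sub>R \<sigma> \<rho> + \<sigma> 0 * indicator {0} \<rho>" for \<rho> :: real
  define J where "J = (LINT \<rho>:{0..1}|lborel. \<sigma> \<rho> * \<rho> ^ (?n - 1))"
  have pos: "0 < \<sigma> \<rho>" if "0 \<le> \<rho>" for \<rho> using \<sigma> that by (simp add: K_class_def)
  have g_eq: "g \<rho> = \<sigma> \<rho>" if "0 \<le> \<rho>" for \<rho> using that by (auto simp: g_def indicator_def)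
  have g_nonneg: "0 \<le> g \<rho>" for \<rho>
    using pos[of \<rho>] pos[of 0] by (auto simp: g_def indicator_def)
  \<comment> \<open>Continuity is given only on the open half-line; the value at 0 enters
    \<open>g\<close> as a separate one-point term.\<close>
  have "(\<lambda>\<rho>. indicator {0<..} \<rho> *\<^sub>R \<sigma> \<rho>) \<in> borel_measurable borel"
    using \<sigma> by (intro borel_measurable_continuous_on_indicator) (auto simp: K_class_def)
  then have g_meas [measurable]: "g \<in> borel_measurable borel"
    unfolding g_def by measurable
  have f_eq: "f x = g (norm (x - y) / r) * indicator (ball y r) x" for x
    by (simp add: f_def g_eq r_def mult.commute)
  show f_meas [measurable]: "f \<in> borel_measurable borel"
    unfolding f_eq[abs_def] by measurable
  have int: "integrable lborel (\<lambda>\<rho>. indicator {0..1} \<rho> *\<^sub>R (\<sigma> \<rho> * \<rho> ^ (?n - 1)))"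
    using \<sigma> by (simp add: K_class_def set_integrable_def)
  have "(\<integral>\<^sup>+\<rho>. ennreal (g \<rho>) * ennreal (\<rho> ^ (?n - 1)) * indicator {0..1} \<rho> \<partial>lborel)
      = (\<integral>\<^sup>+\<rho>. ennreal (indicator {0..1} \<rho> *\<^sub>R (\<sigma> \<rho> * \<rho> ^ (?n - 1))) \<partial>lborel)"
    using pos by (intro nn_integral_cong) (auto simp: indicator_def g_eq ennreal_mult' less_imp_le)
  also have "\<dots> = ennreal J"
    unfolding J_def set_lebesgue_integral_def
    using pos by (intro nn_integral_eq_integral int) (auto simp: indicator_def less_imp_le)
  finally have J: "(\<integral>\<^sup>+\<rho>. ennreal (g \<rho>) * ennreal (\<rho> ^ (?n - 1)) * indicator {0..1} \<rho> \<partial>lborel) = ennreal J" .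
  have J0: "0 \<le> J" unfolding J_def set_lebesgue_integral_def
    using pos by (intro integral_nonneg_AE) (auto simp: indicator_def less_imp_le)
  let ?I = "unit_ball_vol ?n * r ^ ?n * ?n * J"
  have "(\<integral>\<^sup>+x. ennreal (f x) \<partial>lborel)
      = (\<integral>\<^sup>+x. ennreal (g (norm (x - y) / r)) * indicator (ball y r) x \<partial>lborel)"
    by (intro nn_integral_cong) (auto simp: f_eq indicator_def)
  also have "\<dots> = ennreal (unit_ball_vol ?n * r ^ ?n * ?n) * ennreal J"
    using nn_integral_radial_ball[OF r, of "\<lambda>\<rho>. ennreal (g \<rho>)" y] J by simp
  also have "\<dots> = ennreal ?I"
    using r J0 by (simp add: ennreal_mult)
  \<comment> \<open>For a nonnegative measurable function, a finite nonnegative integral yields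
    integrability and the value together.\<close>
  finally have "integrable lborel f \<and> integral\<^sup>L lborel f = ?I"
    using r J0 g_nonneg by (subst (asm) nn_integral_eq_integrable) (auto simp: f_eq)
  moreover have "?I \<le> 2 ^ ?n * r ^ ?n * ?n * J"
    using r J0 unit_ball_vol_le_two_power[where 'n='n] by (intro mult_right_mono) auto
  moreover have "2 ^ ?n * r ^ ?n * ?n * J = real ?n * J / real t ^ ?n"
    by (simp add: r_def power_divide power_mult_distrib)
  ultimately show "integrable lborel f" "integral\<^sup>L lborel f \<le> real ?n * J / real t ^ ?n"
    by simp_all
qed

section \<open>The estimate for a fixed mesh\<close>

text \<open>The difference of powers is the volume of the shell between the cube and its enlargement
  by \<open>1 / real t\<close> on every side; it accounts for lattice cubes that stick out of the
  given cube.\<close>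

lemma nu_integral_bound:
  fixes \<Omega> :: "(real^'n) set" and t :: nat and z :: "real^'n" and a :: real
  assumes \<Omega>: "open \<Omega>" "bounded \<Omega>" and \<sigma>: "\<sigma> \<in> K_class CARD('n)" and a: "0 < a" and t: "0 < t"
  defines "E \<equiv> open_cube z a \<inter> \<Omega>"
  shows "set_integrable lebesgue E (nu \<Omega> \<sigma> t)"
    "(LINT x:E|lebesgue. nu \<Omega> \<sigma> t x) \<le> \<sigma> 1 * measure lebesgue E +
      real CARD('n) * (LINT \<rho>:{0..1}|lborel. \<sigma> \<rho> * \<rho> ^ (CARD('n) - 1)) *
      (measure lebesgue E + ((a + 2 / real t) ^ CARD('n) - a ^ CARD('n)))"
proof -
  let ?n = "CARD('n)"
  let ?X = "X_centres \<Omega> t"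
  define f where "f y x = \<sigma> (2 * real t * norm (x - y)) * indicator (ball y (1 / (2 * real t))) x"
    for x y :: "real^'n"
  define C where "C = real ?n * (LINT \<rho>:{0..1}|lborel. \<sigma> \<rho> * \<rho> ^ (?n - 1))"
  \<comment> \<open>Balls that miss \<open>E\<close> contribute nothing. Discarding them confines
    the remaining lattice cubes to a neighbourhood of \<open>open_cube z a\<close>.\<close>
  define F where "F = {y \<in> ?X. ball y (1 / (2 * real t)) \<inter> E \<noteq> {}}"
  \<comment> \<open>In each coordinate, a point of \<open>open_cube z a\<close> is within
    \<open>1 / (2 * real t)\<close> of some centre in \<open>F\<close>, and that centre is within
    \<open>1 / (2 * real t)\<close> of the points of its cube; the half-side therefore grows by
    \<open>1 / real t\<close>.\<close>
  define L where "L = open_cube z (a + 2 / real t)"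
  have \<Omega>m: "\<Omega> \<in> lmeasurable" using \<Omega> by (simp add: lmeasurable_open)
  have Em: "E \<in> lmeasurable" unfolding E_def
    using \<Omega>m open_cube_lmeasurable by (intro fmeasurable.Int) auto
  have pos: "0 < \<sigma> \<rho>" if "0 \<le> \<rho>" for \<rho> using \<sigma> that by (simp add: K_class_def)
  have finX: "finite ?X" using finite_X_centres[OF t \<Omega>m] .
  have C0: "0 \<le> C" unfolding C_def set_lebesgue_integral_def
    using pos by (intro mult_nonneg_nonneg integral_nonneg_AE) (auto simp: indicator_def less_imp_le)
  have f0: "0 \<le> f y x" for x y using pos by (simp add: f_def less_imp_le)
  note f_props = K_class_ball_integral[OF \<sigma> t, folded f_def C_def]
  have f_int: "integrable lebesgue (f y)" for y
    using f_props(1,2)[of y] by (simp add: integrable_completion)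
  have f_set: "set_integrable lebesgue E (f y)" for y
    unfolding set_integrable_def using f_int Em by (intro integrable_mult_indicator) auto
  have f_le: "(LINT x:E|lebesgue. f y x) \<le> C / real t ^ ?n" for y
  proof -
    have "(LINT x:E|lebesgue. f y x) \<le> integral\<^sup>L lebesgue (f y)"
      unfolding set_lebesgue_integral_def
      using f_set f_int f0 by (intro integral_mono) (auto simp: set_integrable_def indicator_def)
    also have "\<dots> \<le> C / real t ^ ?n"
      using f_props(1,3)[of y] by (simp add: integral_completion)
    finally show ?thesis .
  qed
  have f_zero: "(LINT x:E|lebesgue. f y x) = 0" if "y \<in> ?X - F" for y
  proof -
    have "indicator E x *\<^sub>R f y x = 0" for x
      using that by (auto simp: F_def f_def indicator_def)
    then show ?thesis unfolding set_lebesgue_integral_def by (simp only: Bochner_Integration.integral_zero)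
  qed
  have G: "G_balls \<Omega> t \<in> sets lebesgue"
    by (intro sets_completionI_sets) (auto simp: G_balls_def open_UN intro: borel_open)
  have h_set: "set_integrable lebesgue E (\<lambda>x. \<sigma> 1 * (1 - indicator (G_balls \<Omega> t) x))"
  proof -
    have "set_integrable lebesgue E (\<lambda>x. 1 - indicator (G_balls \<Omega> t) x :: real)"
    proof -
      have "indicator E x *\<^sub>R (1 - indicator (G_balls \<Omega> t) x :: real) = indicator (E - G_balls \<Omega> t) x" for x
        by (auto simp: indicator_def)
      then show ?thesis using fmeasurable_Diff[OF Em G]
        by (simp add: set_integrable_def fmeasurable_def integrable_indicator_iff del: emeasure_completion)
    qed
    then show ?thesis by simp
  qed
  have h_le: "(LINT x:E|lebesgue. \<sigma> 1 * (1 - indicator (G_balls \<Omega> t) x)) \<le> \<sigma> 1 * measure lebesgue E"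
  proof -
    have "(LINT x:E|lebesgue. \<sigma> 1 * (1 - indicator (G_balls \<Omega> t) x)) \<le> (LINT x:E|lebesgue. \<sigma> 1)"
      using pos[of 1] Em
      by (intro set_integral_mono h_set)
        (auto simp: set_integrable_def fmeasurable_def indicator_le_1 simp del: emeasure_completion)
    also have "\<dots> = \<sigma> 1 * measure lebesgue E" by (simp add: set_lebesgue_integral_def mult.commute)
    finally show ?thesis .
  qed
  have nu_eq: "nu \<Omega> \<sigma> t = (\<lambda>x. \<sigma> 1 * (1 - indicator (G_balls \<Omega> t) x) + (\<Sum>y\<in>?X. f y x))"
    by (auto simp: nu_def f_def)
  have sum_set: "set_integrable lebesgue E (\<lambda>x. \<Sum>y\<in>?X. f y x)"
    using f_set by (simp add: set_integrable_def sum_distrib_left)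
  show "set_integrable lebesgue E (nu \<Omega> \<sigma> t)"
    unfolding nu_eq by (intro set_integral_add(1) h_set sum_set)
  have cardF: "real (card F) / real t ^ ?n \<le> measure lebesgue (L \<inter> \<Omega>)"
  proof (rule card_lattice_cubes_le[OF t])
    show "finite F" using finX by (simp add: F_def)
    show "F \<subseteq> Y_lattice t" by (auto simp: F_def X_centres_def)
    show "L \<inter> \<Omega> \<in> lmeasurable" unfolding L_def
      using \<Omega>m open_cube_lmeasurable by (intro fmeasurable.Int) auto
    fix y assume y: "y \<in> F"
    then obtain x where x: "norm (x - y) < 1 / (2 * real t)" "x \<in> open_cube z a"
      by (auto simp: F_def E_def dist_norm norm_minus_commute)
    have "Q_cube t y \<subseteq> L"
    proof
      fix w assume w: "w \<in> Q_cube t y"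
      have "\<bar>w $ i - z $ i\<bar> < (a + 2 / real t) / 2" for i
      proof -
        have "\<bar>x $ i - y $ i\<bar> < 1 / (2 * real t)"
          using component_le_norm_cart[of "x - y" i] x(1) by simp
        moreover have "\<bar>w $ i - y $ i\<bar> < 1 / (2 * real t)" "\<bar>x $ i - z $ i\<bar> < a / 2"
          using w x(2) by (auto simp: Q_cube_def open_cube_def)
        ultimately have "\<bar>w $ i - z $ i\<bar> < 1 / (2 * real t) + 1 / (2 * real t) + a / 2" by linarith
        then show ?thesis by (simp add: field_simps)
      qed
      then show "w \<in> L" by (simp add: L_def open_cube_def)
    qed
    then show "Q_cube t y \<subseteq> L \<inter> \<Omega>" using y by (auto simp: F_def X_centres_def)
  qed
  have L_le: "measure lebesgue (L \<inter> \<Omega>) \<le> measure lebesgue E + ((a + 2 / real t) ^ ?n - a ^ ?n)"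
  proof -
    have sub: "open_cube z a \<subseteq> L"
    proof -
      have "a / 2 \<le> (a + 2 / real t) / 2" by simp
      then show ?thesis unfolding L_def open_cube_def using order_less_le_trans by blast
    qed
    have Lm: "L \<in> lmeasurable" "L - open_cube z a \<in> lmeasurable"
      unfolding L_def using open_cube_lmeasurable by (auto intro!: fmeasurable_Diff fmeasurableD)
    \<comment> \<open>The whole shell is added to \<open>E\<close>, whether or not it lies in
      \<open>\<Omega>\<close>, so its volume is a difference of two cube volumes and no regularity
      of the boundary of \<open>\<Omega>\<close> enters.\<close>
    have "measure lebesgue (L \<inter> \<Omega>) \<le> measure lebesgue (E \<union> (L - open_cube z a))"
      using Em Lm \<Omega>m by (intro measure_mono_fmeasurable fmeasurable.Un) (auto simp: E_def fmeasurableD)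
    also have "\<dots> \<le> measure lebesgue E + measure lebesgue (L - open_cube z a)"
      using Em Lm by (intro measure_Un_le) auto
    also have "measure lebesgue (L - open_cube z a) = measure lebesgue L - measure lebesgue (open_cube z a)"
      using Lm sub open_cube_lmeasurable
      by (intro measurable_measure_Diff) (auto simp: fmeasurableD)
    also have "\<dots> = (a + 2 / real t) ^ ?n - a ^ ?n"
      using a t by (simp add: L_def measure_open_cube add_pos_pos)
    finally show ?thesis by simp
  qed
  have "(LINT x:E|lebesgue. nu \<Omega> \<sigma> t x) = (LINT x:E|lebesgue. \<sigma> 1 * (1 - indicator (G_balls \<Omega> t) x))
      + (LINT x:E|lebesgue. (\<Sum>y\<in>?X. f y x))"
    unfolding nu_eq by (intro set_integral_add(2) h_set sum_set)
  also have "(LINT x:E|lebesgue. (\<Sum>y\<in>?X. f y x)) = (\<Sum>y\<in>?X. LINT x:E|lebesgue. f y x)"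
    using f_set unfolding set_lebesgue_integral_def set_integrable_def scaleR_sum_right
    by (intro Bochner_Integration.integral_sum)
  also have "\<dots> = (\<Sum>y\<in>F. LINT x:E|lebesgue. f y x)"
    using finX f_zero by (intro sum.mono_neutral_right) (auto simp: F_def)
  also have "\<dots> \<le> real (card F) * (C / real t ^ ?n)"
    using f_le by (intro sum_bounded_above) auto
  also have "\<dots> = C * (real (card F) / real t ^ ?n)" by simp
  also have "\<dots> \<le> C * (measure lebesgue E + ((a + 2 / real t) ^ ?n - a ^ ?n))"
    using cardF L_le C0 by (intro mult_left_mono) auto
  finally show "(LINT x:E|lebesgue. nu \<Omega> \<sigma> t x) \<le> \<sigma> 1 * measure lebesgue E +
      C * (measure lebesgue E + ((a + 2 / real t) ^ ?n - a ^ ?n))"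
    using h_le by simp
qed

section \<open>Passage to the limit\<close>

theorem theorem5p3:
  fixes \<Omega> :: "(real^'n) set" and \<sigma> :: "real \<Rightarrow> real" and m :: nat
    and Q :: "(real^'n) set" and z :: "real^'n" and a :: real
  assumes "2 \<le> CARD('n)"
    and "open \<Omega>" and "connected \<Omega>" and "\<Omega> \<noteq> {}" and "bounded \<Omega>"
    and "1 \<le> m" and "\<forall>t>m. X_centres \<Omega> t \<noteq> {}"
    and "\<sigma> \<in> K_class CARD('n)"
    and "0 < a" and "Q = open_cube z a"
  shows "(\<forall>t\<ge>1. set_integrable lebesgue (Q \<inter> \<Omega>) (nu \<Omega> \<sigma> (m + t))) \<and>
         limsup (\<lambda>t. ereal (LINT x:Q \<inter> \<Omega>|lebesgue. nu \<Omega> \<sigma> (m + t) x))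
           \<le> ereal (M_const CARD('n) \<sigma> * measure lebesgue (Q \<inter> \<Omega>))"
proof (intro conjI allI impI)
  let ?n = "CARD('n)"
  define A where "A = measure lebesgue (Q \<inter> \<Omega>)"
  define C where "C = real ?n * (LINT \<rho>:{0..1}|lborel. \<sigma> \<rho> * \<rho> ^ (?n - 1))"
  define b where "b t = \<sigma> 1 * A + C * (A + ((a + 2 / real (m + t)) ^ ?n - a ^ ?n))" for t
  \<comment> \<open>Since \<open>m\<close> is at least 1, the estimate holds at every index,
    including \<open>t = 0\<close>, and the two sequences can be compared termwise.\<close>
  have pos: "0 < m + t" for t using assms(6) by simp
  note bound = nu_integral_bound[OF assms(2,5,8,9) pos, of z, folded assms(10), folded A_def C_def]
  show "set_integrable lebesgue (Q \<inter> \<Omega>) (nu \<Omega> \<sigma> (m + t))" for t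
    using bound(1) .
  have "(\<lambda>t. 2 / real (m + t)) \<longlonglongrightarrow> 0"
    using LIMSEQ_ignore_initial_segment[OF lim_const_over_n[of 2], of m] by (simp add: add.commute)
  \<comment> \<open>The shell term vanishes in the limit, leaving
    \<open>(\<sigma> 1 + C) * A\<close>, where \<open>\<sigma> 1 + C\<close> is
    \<open>M_const\<close>.\<close>
  then have "b \<longlonglongrightarrow> \<sigma> 1 * A + C * (A + ((a + 0) ^ ?n - a ^ ?n))"
    unfolding b_def by (intro tendsto_intros)
  then have "limsup (\<lambda>t. ereal (b t)) = ereal (M_const ?n \<sigma> * A)"
    by (intro lim_imp_Limsup) (auto simp: M_const_def C_def algebra_simps)
  moreover have "limsup (\<lambda>t. ereal (LINT x:Q \<inter> \<Omega>|lebesgue. nu \<Omega> \<sigma> (m + t) x)) \<le> limsup (\<lambda>t. ereal (b t))"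
    using bound(2) by (intro Limsup_mono always_eventually) (auto simp: b_def)
  ultimately show "limsup (\<lambda>t. ereal (LINT x:Q \<inter> \<Omega>|lebesgue. nu \<Omega> \<sigma> (m + t) x))
      \<le> ereal (M_const ?n \<sigma> * measure lebesgue (Q \<inter> \<Omega>))"
    by (simp add: A_def)
qed

end
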